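(* Let $r,s\ge 1$ and $t\ge 2$ be integers, and let $\rho\in\mathcal{P}_{r,s}$ be a $t$-core. Let $\mathcal{D}^t_{r,s}(\rho)=\{\lambda\in\mathcal{P}_{r,s}\mid \mathrm{core}_t(\lambda)=\rho\}$. Let $n_i=\left\lfloor\frac{r+s+t-1-i}{t}\right\rfloor$ for $0\le i\le t-1$, and let $a_i=|v^i|$, where $(v^0,\dots,v^{t-1})$ is the $t$-tuple of binary words associated to $\rho$ (as a partition in $\mathcal{P}_{r,s}$). Then $$\sum_{\lambda\in\mathcal{D}^t_{r,s}(\rho)}q^{|\lambda|}=q^{|\rho|}\prod_{i=0}^{t-1}\begin{bmatrix} n_i\\ a_i\end{bmatrix}_{q^t}.$$
   Context: A partition $\lambda=(\lambda_1\ge\lambda_2\ge\cdots)$ is a weakly decreasing finite sequence of positive integers (possibly empty), extended by $\lambda_j=0$ for $j>\ell(\lambda)$, where $\ell(\lambda)$ is the number of parts; $|\lambda|=\sum_j\lambda_j$. $\mathcal{P}_{r,s}$ is the set of partitions with $\ell(\lambda)\le r$ and $\lambda_1\le s$. A rim-hook of $\lambda$ is a connected skew shape $\lambda/\mu$ (with $\mu\subseteq\lambda$ a partition) containing no $2\times2$ block of boxes; a $t$-rim hook is one with exactly $t$ boxes. The $t$-core $\mathrm{core}_t(\lambda)$ is the partition obtained by successively removing $t$-rim hooks until none can be removed (it does not depend on the order of removals); $\lambda$ is a $t$-core if $\mathrm{core}_t(\lambda)=\lambda$. Words associated to a partition $\lambda\in\mathcal{P}_{r,s}$: the balanced abacus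 of $\lambda$ is the word $w=(w_m)_{m\in\mathbb{Z}}$ in $\{0,1\}$ with $w_m=1$ if $m=\lambda_j-j$ for some $j\ge1$ and $w_m=0$ otherwise (equivalently, it traces the boundary of $\lambda$ with $1$ for an up step and $0$ for a right step, normalised so that $|\{m\ge0: w_m=1\}|=|\{m<0:w_m=0\}|$). With $n_i=\left\lfloor\frac{r+s+t-1-i}{t}\right\rfloor$, set $$v^i=(w_{-r+i},\,w_{-r+i+t},\,\dots,\,w_{-r+i+t(n_i-1)}),\qquad 0\le i\le t-1.$$ For a binary word $v$, $|v|$ denotes the number of $1$'s in $v$. $\begin{bmatrix} n\\ a\end{bmatrix}_{q}$ denotes the $q$-binomial coefficient (Gaussian polynomial), and the subscript $q^t$ means $q$ is replaced by $q^t$. *)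

theory Defs
  imports "HOL-Computational_Algebra.Polynomial"
begin

definition is_partition :: "nat list \<Rightarrow> bool" where
  "is_partition lam \<longleftrightarrow> sorted_wrt (\<ge>) lam \<and> 0 \<notin> set lam"

text \<open>Parts are numbered from 1. The value at \<open>j = 0\<close> is a dummy and is never used below.\<close>

definition part :: "nat list \<Rightarrow> nat \<Rightarrow> nat" where
  "part lam j = (if 1 \<le> j \<and> j \<le> length lam then lam ! (j - 1) else 0)"

definition partitions_in :: "nat \<Rightarrow> nat \<Rightarrow> nat list set" where
  "partitions_in r s = {lam. is_partition lam \<and> length lam \<le> r \<and> part lam 1 \<le> s}"

text \<open>Boxes are pairs (row, column), both counted from 1.\<close>

definition diagram :: "nat list \<Rightarrow> (nat \<times> nat) set" where
  "diagram lam = {(i, j). 1 \<le> i \<and> i \<le> length lam \<and> 1 \<le> j \<and> j \<le> part lam i}"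

definition adjacent_boxes :: "((nat \<times> nat) \<times> (nat \<times> nat)) set" where
  "adjacent_boxes = {((i, j), (i', j')).
     (i = i' \<and> (j' = Suc j \<or> j = Suc j')) \<or> (j = j' \<and> (i' = Suc i \<or> i = Suc i'))}"

definition connected_boxes :: "(nat \<times> nat) set \<Rightarrow> bool" where
  "connected_boxes S \<longleftrightarrow>
     (\<forall>x\<in>S. \<forall>y\<in>S. (x, y) \<in> (adjacent_boxes \<inter> S \<times> S)\<^sup>*)"

definition contains_2x2 :: "(nat \<times> nat) set \<Rightarrow> bool" where
  "contains_2x2 S \<longleftrightarrow>
     (\<exists>i j. {(i, j), (i, Suc j), (Suc i, j), (Suc i, Suc j)} \<subseteq> S)"

definition removes_rim_hook :: "nat \<Rightarrow> nat list \<Rightarrow> nat list \<Rightarrow> bool" where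
  "removes_rim_hook t lam mu \<longleftrightarrow>
     is_partition lam \<and> is_partition mu \<and> diagram mu \<subseteq> diagram lam \<and>
     connected_boxes (diagram lam - diagram mu) \<and>
     \<not> contains_2x2 (diagram lam - diagram mu) \<and>
     card (diagram lam - diagram mu) = t"

text \<open>The definite description is legitimate because, for \<open>t \<ge> 1\<close>, the result does not depend
  on the order of removals.\<close>

definition core :: "nat \<Rightarrow> nat list \<Rightarrow> nat list" where
  "core t lam =
     (THE mu. (removes_rim_hook t)\<^sup>*\<^sup>* lam mu \<and> (\<nexists>nu. removes_rim_hook t mu nu))"

definition is_core :: "nat \<Rightarrow> nat list \<Rightarrow> bool" where
  "is_core t lam \<longleftrightarrow> core t lam = lam"

definition partitions_with_core :: "nat \<Rightarrow> nat \<Rightarrow> nat \<Rightarrow> nat list \<Rightarrow> nat list set" where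
  "partitions_with_core t r s rho = {lam \<in> partitions_in r s. core t lam = rho}"

lemma finite_partitions_in: "finite (partitions_in r s)"
proof (rule finite_subset)
  show "partitions_in r s \<subseteq> {xs. set xs \<subseteq> {..s} \<and> length xs \<le> r}"
  proof
    fix lam assume a: "lam \<in> partitions_in r s"
    have "x \<le> s" if "x \<in> set lam" for x
    proof (cases lam)
      case Nil
      with that show ?thesis by simp
    next
      case (Cons y ys)
      with a that show ?thesis
        by (auto simp: partitions_in_def is_partition_def part_def)
    qed
    with a show "lam \<in> {xs. set xs \<subseteq> {..s} \<and> length xs \<le> r}"
      by (auto simp: partitions_in_def)
  qed
qed (simp add: finite_lists_length_le)

lemma finite_partitions_with_core: "finite (partitions_with_core t r s rho)"
  by (simp add: partitions_with_core_def finite_partitions_in)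

definition abacus :: "nat list \<Rightarrow> int \<Rightarrow> nat" where
  "abacus lam m = (if \<exists>j\<ge>1. m = int (part lam j) - int j then 1 else 0)"

definition runner_length :: "nat \<Rightarrow> nat \<Rightarrow> nat \<Rightarrow> nat \<Rightarrow> nat" where
  "runner_length r s t i = (r + s + t - 1 - i) div t"

definition runner_word :: "nat \<Rightarrow> nat \<Rightarrow> nat \<Rightarrow> nat list \<Rightarrow> nat \<Rightarrow> nat list" where
  "runner_word r s t lam i =
     map (\<lambda>k. abacus lam (- int r + int i + int t * int k)) [0..<runner_length r s t i]"

definition ones :: "nat list \<Rightarrow> nat" where
  "ones v = count_list v 1"

text \<open>The indeterminate \<open>q\<close> is \<open>monom 1 1\<close>.\<close>

definition q_int :: "nat \<Rightarrow> int poly" where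
  "q_int n = (\<Sum>k<n. monom 1 k)"

definition q_fact :: "nat \<Rightarrow> int poly" where
  "q_fact n = (\<Prod>k=1..n. q_int k)"

text \<open>The division is exact, see \<open>q_binomial_mult\<close>.\<close>

definition q_binomial :: "nat \<Rightarrow> nat \<Rightarrow> int poly" where
  "q_binomial n a = (if a \<le> n then q_fact n div (q_fact a * q_fact (n - a)) else 0)"

lemma q_int_add: "q_int (a + b) = q_int a + monom 1 a * q_int b"
  by (induction b) (simp_all add: q_int_def distrib_left mult_monom add.assoc)

lemma q_fact_0: "q_fact 0 = 1"
  by (simp add: q_fact_def)

lemma q_fact_Suc: "q_fact (Suc n) = q_int (Suc n) * q_fact n"
  by (simp add: q_fact_def mult.commute)

lemma q_fact_dvd: "q_fact a * q_fact b dvd q_fact (a + b)"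
proof (induction "a + b" arbitrary: a b)
  case 0
  then show ?case by (simp add: q_fact_0)
next
  case (Suc n)
  show ?case
  proof (cases "a = 0 \<or> b = 0")
    case True
    then show ?thesis by (auto simp: q_fact_0)
  next
    case False
    then obtain c d where cd: "a = Suc c" "b = Suc d"
      by (metis not0_implies_Suc)
    have 1: "q_fact c * q_fact b dvd q_fact n" and 2: "q_fact a * q_fact d dvd q_fact n"
      using Suc.hyps(1)[of c b] Suc.hyps(1)[of a d] Suc.hyps(2) cd by simp_all
    have eq: "q_fact (a + b) = q_int a * q_fact n + monom 1 a * (q_int b * q_fact n)"
      using q_fact_Suc[of n] q_int_add[of a b] Suc.hyps(2) by (simp add: algebra_simps)
    have "q_int a * (q_fact c * q_fact b) dvd q_int a * q_fact n"
      using 1 by (rule mult_dvd_mono[OF dvd_refl])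
    then have 3: "q_fact a * q_fact b dvd q_int a * q_fact n"
      by (simp add: cd q_fact_Suc mult_ac)
    have "q_int b * (q_fact a * q_fact d) dvd q_int b * q_fact n"
      using 2 by (rule mult_dvd_mono[OF dvd_refl])
    then have 4: "q_fact a * q_fact b dvd q_int b * q_fact n"
      by (simp add: cd q_fact_Suc mult_ac)
    show ?thesis
      unfolding eq by (rule dvd_add[OF 3 dvd_mult[OF 4]])
  qed
qed

lemma q_binomial_mult:
  assumes "a \<le> n"
  shows "q_binomial n a * (q_fact a * q_fact (n - a)) = q_fact n"
  using q_fact_dvd[of a "n - a"] assms by (simp add: q_binomial_def)

end

theory Submission
  imports Defs "HOL-Library.FuncSet"
begin

text \<open>
  Shift the abacus by \<open>r\<close> and keep only the first \<open>r\<close> beads: a partition with at most \<open>r\<close> parts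
  becomes an \<open>r\<close>-element set of naturals, and it lies in the \<open>r \<times> s\<close> box iff this set lies below
  \<open>r + s\<close>. Removing a \<open>t\<close>-rim hook moves one bead from \<open>b + t\<close> to a free position \<open>b\<close>. So the
  number of beads on each runner (residue class modulo \<open>t\<close>) is invariant, and nothing can be
  removed iff on every runner the beads are pushed to the bottom. Hence the partitions in the box
  with a given core correspond to independent choices of \<open>a\<^sub>i\<close>-subsets of \<open>{..<n\<^sub>i}\<close>, and since
  \<open>|lam|\<close> is the sum of the bead positions up to a constant, each runner contributes a
  \<open>q\<close>-binomial coefficient in \<open>q^t\<close>.
\<close>

subsection \<open>Partitions and their diagrams\<close>

lemma part_mono:
  assumes "is_partition lam" "1 \<le> i" "i \<le> j"
  shows "part lam j \<le> part lam i"
proof (cases "i = j \<or> length lam < j")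
  case False
  then have "lam ! (j - 1) \<le> lam ! (i - 1)"
    using assms by (auto simp: is_partition_def sorted_wrt_iff_nth_less)
  then show ?thesis using False assms by (auto simp: part_def)
qed (auto simp: part_def)

lemma part_pos_iff:
  assumes "is_partition lam" "1 \<le> j"
  shows "0 < part lam j \<longleftrightarrow> j \<le> length lam"
proof -
  have "lam ! (j - 1) \<noteq> 0" if "j \<le> length lam"
  proof -
    have "lam ! (j - 1) \<in> set lam" using assms(2) that by (intro nth_mem) simp
    then show ?thesis using assms(1) unfolding is_partition_def by metis
  qed
  then show ?thesis using assms(2) by (auto simp: part_def)
qed

lemma partition_eqI:
  assumes "is_partition lam" "is_partition mu" "\<And>j. 1 \<le> j \<Longrightarrow> part lam j = part mu j"
  shows "lam = mu"
proof (rule nth_equalityI)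
  have "j \<le> length lam \<longleftrightarrow> j \<le> length mu" if "1 \<le> j" for j
    using part_pos_iff[OF assms(1) that] part_pos_iff[OF assms(2) that] assms(3)[OF that] by simp
  then show "length lam = length mu"
    by (metis One_nat_def Suc_leI linorder_neqE_nat nat_neq_iff not_less_zero le_refl
        less_le_not_le neq0_conv)
  then show "lam ! i = mu ! i" if "i < length lam" for i
    using assms(3)[of "Suc i"] that by (simp add: part_def)
qed

text \<open>The support of such an \<open>f\<close> is an initial segment, and listing the values on
  it gives the partition. Constructions can thus prescribe row lengths by a formula.\<close>

lemma ex_partition:
  assumes mono: "\<And>i. 1 \<le> i \<Longrightarrow> f (Suc i) \<le> (f i :: nat)" and zero: "\<And>i. r < i \<Longrightarrow> f i = 0"
  shows "\<exists>lam. is_partition lam \<and> length lam \<le> r \<and> (\<forall>i\<ge>1. part lam i = f i)"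
proof -
  have anti: "f j \<le> f i" if "1 \<le> i" "i \<le> j" for i j
    using that(2,1) by (induction j rule: dec_induct) (auto intro: le_trans[OF mono])
  define N where "N = {j. 1 \<le> j \<and> 0 < f j}"
  have sub: "N \<subseteq> {1..r}"
    using zero by (force simp: N_def not_less[symmetric])
  then have fin: "finite N" by (rule finite_subset) simp
  define n where "n = card N"
  have N: "N = {1..n}"
  proof (cases "N = {}")
    case False
    have "N = {1..Max N}"
    proof
      show "N \<subseteq> {1..Max N}" using fin by (auto simp: N_def)
      have "0 < f (Max N)" using Max_in[OF fin False] by (simp add: N_def)
      then show "{1..Max N} \<subseteq> N" using anti by (fastforce simp: N_def)
    qed
    then show ?thesis unfolding n_def by (metis card_atLeastAtMost diff_Suc_1)
  qed (simp add: n_def)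
  define lam where "lam = map f [1..<Suc n]"
  have pos: "0 < f i" if "i \<in> {1..n}" for i
    using that N unfolding N_def by blast
  have "sorted_wrt (\<ge>) lam"
    using anti by (auto simp: lam_def sorted_wrt_iff_nth_less simp del: upt_Suc)
  moreover have "0 \<notin> set lam"
    using pos by (force simp: lam_def simp del: upt_Suc)
  ultimately have "is_partition lam" by (simp add: is_partition_def)
  moreover have "length lam \<le> r"
    using card_mono[OF _ sub] by (simp add: lam_def n_def)
  moreover have "part lam i = f i" if "i \<ge> 1" for i
  proof -
    have "i \<in> N \<longleftrightarrow> i \<le> n" using that by (simp add: N)
    then have "0 < f i \<longleftrightarrow> i \<le> n" using that by (simp add: N_def)
    then show ?thesis
      using that by (cases "i \<le> n") (simp_all add: part_def lam_def del: upt_Suc)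
  qed
  ultimately show ?thesis by blast
qed

lemma diagram_eq_Sigma: "diagram lam = Sigma {1..length lam} (\<lambda>i. {1..part lam i})"
  by (auto simp: diagram_def)

lemma mem_diagram: "(i, j) \<in> diagram lam \<longleftrightarrow> 1 \<le> i \<and> 1 \<le> j \<and> j \<le> part lam i"
  by (auto simp: diagram_def part_def split: if_splits)

lemma finite_diagram: "finite (diagram lam)"
  by (simp add: diagram_eq_Sigma)

lemma sum_part:
  assumes "length lam \<le> r"
  shows "(\<Sum>j=1..r. part lam j) = sum_list lam"
proof -
  have "(\<Sum>j=1..r. part lam j) = (\<Sum>j=1..length lam. part lam j)"
    using assms by (intro sum.mono_neutral_right) (auto simp: part_def)
  also have "\<dots> = (\<Sum>j<length lam. lam ! j)"
    by (rule sum.reindex_bij_witness[of _ Suc "\<lambda>j. j - 1"]) (auto simp: part_def)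
  finally show ?thesis by (simp add: sum_list_sum_nth atLeast0LessThan)
qed

lemma card_diagram: "card (diagram lam) = sum_list lam"
  using sum_part[of lam "length lam"] by (simp add: diagram_eq_Sigma card_SigmaI)

subsection \<open>Bead sets\<close>

text \<open>The abacus bead \<open>part lam j - j\<close> moved up by \<open>r\<close>. The
  truncated subtraction is exact on the rows \<open>1..r\<close> over which \<open>beta\<close>
  ranges.\<close>

definition bead :: "nat \<Rightarrow> nat list \<Rightarrow> nat \<Rightarrow> nat" where
  "bead r lam j = part lam j + (r - j)"

definition beta :: "nat \<Rightarrow> nat list \<Rightarrow> nat set" where
  "beta r lam = bead r lam ` {1..r}"

lemma bead_less:
  assumes "is_partition lam" "1 \<le> i" "i < j" "j \<le> r"
  shows "bead r lam j < bead r lam i"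
  using part_mono[of lam i j] assms by (simp add: bead_def)

lemma inj_on_bead: "is_partition lam \<Longrightarrow> inj_on (bead r lam) {1..r}"
  by (rule linorder_inj_onI') (metis bead_less atLeastAtMost_iff less_irrefl)

lemma finite_beta [simp]: "finite (beta r lam)"
  by (simp add: beta_def)

lemma card_beta: "is_partition lam \<Longrightarrow> card (beta r lam) = r"
  unfolding beta_def using card_image[OF inj_on_bead] by (metis card_atLeastAtMost diff_Suc_1)

text \<open>The offset depends only on \<open>r\<close>, so differences of partition sizes can be
  read off as differences of bead sums.\<close>

lemma sum_beta:
  assumes "is_partition lam" "length lam \<le> r"
  shows "\<Sum>(beta r lam) = sum_list lam + (\<Sum>j=1..r. r - j)"
  using sum.reindex[OF inj_on_bead[OF assms(1)], of "\<lambda>x. x" r] sum_part[OF assms(2)]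
  unfolding beta_def bead_def by (simp only: sum.distrib comp_def)

text \<open>Beads strictly decrease down the rows, so row \<open>j\<close> holds the
  \<open>j\<close>-th largest element of the set.\<close>

lemma beta_inject:
  assumes lam: "is_partition lam" "length lam \<le> r" and mu: "is_partition mu" "length mu \<le> r"
    and eq: "beta r lam = beta r mu"
  shows "lam = mu"
proof -
  \<comment> \<open>Stated for arbitrary partitions because it is applied in both directions to get
    equality.\<close>
  have step: "bead r mu j \<le> bead r lam j"
    if lm: "is_partition lam" "is_partition mu" and eq: "beta r lam = beta r mu" and j: "j \<in> {1..r}"
      and IH: "\<And>i. i \<in> {1..r} \<Longrightarrow> i < j \<Longrightarrow> bead r lam i = bead r mu i" for lam mu j
  proof -
    obtain i where i: "i \<in> {1..r}" "bead r mu j = bead r lam i"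
      using eq j unfolding beta_def by blast
    have "\<not> i < j"
      using IH[of i] i bead_less[OF lm(2), of i j r] j by auto
    then show ?thesis
      using bead_less[OF lm(1), of j i r] i j by (cases "i = j") auto
  qed
  have bead: "j \<in> {1..r} \<Longrightarrow> bead r lam j = bead r mu j" for j
  proof (induction j rule: less_induct)
    case (less j)
    then show ?case
      using step[OF lam(1) mu(1) eq, of j] step[OF mu(1) lam(1) eq[symmetric], of j] by force
  qed
  show ?thesis
  proof (rule partition_eqI[OF lam(1) mu(1)])
    fix j :: nat assume "1 \<le> j"
    then show "part lam j = part mu j"
      using bead[of j] lam mu by (cases "j \<le> r") (auto simp: bead_def part_def)
  qed
qed

text \<open>Row \<open>j\<close> receives the \<open>j\<close>-th largest element of
  \<open>B\<close>, lowered by the number \<open>r - j\<close> of smaller elements.\<close>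

lemma ex_beta:
  assumes fin: "finite B" and card: "card B = r"
  shows "\<exists>lam. is_partition lam \<and> length lam \<le> r \<and> beta r lam = B"
proof -
  define xs where "xs = sorted_list_of_set B"
  have len: "length xs = r" and set: "set xs = B" and "sorted_wrt (<) xs"
    using assms by (simp_all add: xs_def)
  then have less: "xs ! i < xs ! j" if "i < j" "j < r" for i j
    using that by (simp add: sorted_wrt_iff_nth_less)
  \<comment> \<open>This lower bound keeps the subtraction in \<open>f\<close> from being
    truncated.\<close>
  have id: "i \<le> xs ! i" if "i < r" for i
    using that
  proof (induction i)
    case (Suc i)
    then show ?case using less[of i "Suc i"] by simp
  qed simp
  define f where "f j = (if j \<le> r then xs ! (r - j) - (r - j) else 0)" for j
  have mono: "f (Suc i) \<le> f i" if "1 \<le> i" for i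
  proof (cases "Suc i \<le> r")
    case True
    then have "xs ! (r - Suc i) < xs ! (r - i)" using that by (intro less) auto
    then show ?thesis using True by (simp add: f_def)
  qed (simp add: f_def)
  obtain lam where lam: "is_partition lam" "length lam \<le> r" "\<And>i. i \<ge> 1 \<Longrightarrow> part lam i = f i"
    using ex_partition[of f r, OF mono] by (auto simp: f_def)
  have "bead r lam j = xs ! (r - j)" if "j \<in> {1..r}" for j
    using that lam(3)[of j] id[of "r - j"] by (simp add: bead_def f_def)
  then have "beta r lam = (\<lambda>j. xs ! (r - j)) ` {1..r}"
    unfolding beta_def by (rule image_cong[OF refl])
  also have "\<dots> = (!) xs ` ((\<lambda>j. r - j) ` {1..r})" by (simp add: image_image)
  also have "(\<lambda>j. r - j) ` {1..r} = {..<r}"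
  proof (intro subset_antisym subsetI)
    fix i assume "i \<in> {..<r}"
    then have "i = r - (r - i)" "r - i \<in> {1..r}" by auto
    then show "i \<in> (\<lambda>j. r - j) ` {1..r}" by (rule image_eqI)
  qed auto
  also have "(!) xs ` {..<r} = B"
    using len set by (auto simp: set_conv_nth)
  finally show ?thesis using lam by blast
qed

lemma beta_subset_iff:
  assumes "is_partition lam" "length lam \<le> r" "1 \<le> r"
  shows "beta r lam \<subseteq> {..<r + s} \<longleftrightarrow> part lam 1 \<le> s"
proof
  assume "beta r lam \<subseteq> {..<r + s}"
  moreover have "bead r lam 1 \<in> beta r lam" using assms(3) by (simp add: beta_def)
  ultimately have "bead r lam 1 < r + s" by blast
  then show "part lam 1 \<le> s" using assms(3) by (simp add: bead_def)
next
  assume s: "part lam 1 \<le> s"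
  show "beta r lam \<subseteq> {..<r + s}"
  proof
    fix x assume "x \<in> beta r lam"
    then obtain j where j: "1 \<le> j" "j \<le> r" "x = part lam j + (r - j)"
      by (auto simp: beta_def bead_def)
    then show "x \<in> {..<r + s}"
      using part_mono[OF assms(1), of 1 j] s by simp
  qed
qed

subsection \<open>Rim hooks and bead moves\<close>

text \<open>This is the effect of a rim hook on the beads: in the rows from \<open>a\<close> to
  \<open>c - 1\<close> each new bead is the old bead of the next row, so only \<open>f a\<close> is
  lost and only row \<open>c\<close> needs a new value.\<close>

lemma image_cyclic_shift:
  fixes f g :: "nat \<Rightarrow> 'a"
  assumes "1 \<le> a" "a \<le> c" "c \<le> r" and inj: "inj_on f {1..r}"
    and shift: "\<And>i. a \<le> i \<Longrightarrow> i < c \<Longrightarrow> g i = f (Suc i)"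
    and out: "\<And>i. i \<in> {1..r} \<Longrightarrow> i < a \<or> c < i \<Longrightarrow> g i = f i"
  shows "g ` {1..r} = insert (g c) (f ` {1..r} - {f a})"
proof -
  have 1: "{1..r} = insert c ({1..<a} \<union> {a..<c} \<union> {c<..r})"
    and 2: "{1..r} - {a} = {1..<a} \<union> Suc ` {a..<c} \<union> {c<..r}"
    using assms(1-3) by (auto simp: image_Suc_atLeastLessThan)
  have "f ` {1..r} - {f a} = f ` ({1..r} - {a})"
    using inj_on_image_set_diff[OF inj, of "{1..r}" "{a}"] assms(1-3) by simp
  also have "\<dots> = f ` {1..<a} \<union> (\<lambda>i. f (Suc i)) ` {a..<c} \<union> f ` {c<..r}"
    unfolding 2 by (simp only: image_Un image_image)
  also have "f ` {1..<a} = g ` {1..<a}"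
    using out assms(1-3) by (intro image_cong) auto
  also have "f ` {c<..r} = g ` {c<..r}"
    using out assms(1-3) by (intro image_cong) auto
  also have "(\<lambda>i. f (Suc i)) ` {a..<c} = g ` {a..<c}"
    using shift by (intro image_cong) auto
  finally show ?thesis unfolding 1 image_insert image_Un by blast
qed

definition bead_move :: "nat \<Rightarrow> nat set \<Rightarrow> nat set \<Rightarrow> bool" where
  "bead_move t B B' \<longleftrightarrow> (\<exists>b. b + t \<in> B \<and> b \<notin> B \<and> B' = insert b (B - {b + t}))"

text \<open>Adjacent boxes differ by at most one row, so a path that leaves the rows up to
  \<open>k\<close> takes a vertical step from row \<open>k\<close> to row \<open>Suc k\<close>, and
  the column of that step is the witness.\<close>

lemma connected_boxes_crossing:
  assumes "(x, y) \<in> (adjacent_boxes \<inter> S \<times> S)\<^sup>*" "fst x \<le> k" "k < fst y"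
  shows "\<exists>j. (k, j) \<in> S \<and> (Suc k, j) \<in> S"
  using assms
proof (induction rule: rtrancl_induct)
  case (step y z)
  then show ?case
  proof (cases "k < fst y")
    case False
    then have "fst y = k" "fst z = Suc k" "snd z = snd y" "y \<in> S" "z \<in> S"
      using step by (auto simp: adjacent_boxes_def)
    then show ?thesis by (metis prod.collapse)
  qed auto
qed simp

text \<open>The hook occupies the rows \<open>a\<close> to \<open>c\<close>, and each of its rows
  after the first ends one column past the remaining part of the row above. So the beads shift
  cyclically, and comparing bead sums shows that the replaced bead went down by exactly
  \<open>t\<close>.\<close>

lemma rim_hook_bead_move:
  assumes hook: "removes_rim_hook t lam mu" and t: "1 \<le> t" and len: "length lam \<le> r"
  shows "length mu \<le> r \<and> bead_move t (beta r lam) (beta r mu) \<and> sum_list lam = sum_list mu + t"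
proof -
  define S where "S = diagram lam - diagram mu"
  have lam: "is_partition lam" and mu: "is_partition mu" and sub: "diagram mu \<subseteq> diagram lam"
    and conn: "connected_boxes S" and no2: "\<not> contains_2x2 S" and card: "card S = t"
    using hook by (simp_all add: removes_rim_hook_def S_def)
  have S: "(i, j) \<in> S \<longleftrightarrow> 1 \<le> i \<and> part mu i < j \<and> j \<le> part lam i" for i j
    by (auto simp: S_def mem_diagram)
  have le: "part mu i \<le> part lam i" if "1 \<le> i" for i
  proof (rule ccontr)
    assume "\<not> ?thesis"
    then have "(i, part mu i) \<in> diagram mu - diagram lam" using that by (auto simp: mem_diagram)
    then show False using sub by blast
  qed
  have size: "sum_list lam = sum_list mu + t"
    using card_Diff_subset[OF finite_diagram sub] card_mono[OF finite_diagram sub] card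
    by (simp add: S_def card_diagram)
  have lenmu: "length mu \<le> r"
  proof (rule ccontr)
    assume "\<not> ?thesis"
    then have "part mu (length mu) = 0"
      using le[of "length mu"] len by (simp add: part_def)
    moreover have "0 < part mu (length mu)"
      using \<open>\<not> length mu \<le> r\<close> part_pos_iff[OF mu, of "length mu"] by simp
    ultimately show False by simp
  qed
  define R where "R = fst ` S"
  have R: "i \<in> R \<longleftrightarrow> 1 \<le> i \<and> part mu i < part lam i" for i
  proof -
    have "i \<in> R \<longleftrightarrow> (\<exists>j. (i, j) \<in> S)" by (force simp: R_def)
    then show ?thesis by (auto simp: S)
  qed
  have "R \<subseteq> {1..r}"
    using len by (fastforce simp: R part_def split: if_splits)
  then have finR: "finite R" by (rule finite_subset) simp
  have "R \<noteq> {}" using card t by (auto simp: R_def)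
  define a where "a = Min R"
  define c where "c = Max R"
  have ac: "a \<in> R" "c \<in> R" "a \<le> c" and outR: "i < a \<or> c < i \<Longrightarrow> i \<notin> R" for i
    using finR \<open>R \<noteq> {}\<close> by (auto simp: a_def c_def)
  then have range: "1 \<le> a" "c \<le> r" using \<open>R \<subseteq> {1..r}\<close> by auto
  \<comment> \<open>Connectedness forces consecutive rows to share a column, and without a 2x2 block they share
    only one.\<close>
  have shift: "part lam (Suc k) = Suc (part mu k)" if k: "a \<le> k" "k < c" for k
  proof -
    have "(a, part lam a) \<in> S" "(c, part lam c) \<in> S"
      using ac by (simp_all add: S R)
    then have "((a, part lam a), (c, part lam c)) \<in> (adjacent_boxes \<inter> S \<times> S)\<^sup>*"
      using conn unfolding connected_boxes_def by blast
    then obtain j where j: "(k, j) \<in> S" "(Suc k, j) \<in> S"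
      using connected_boxes_crossing[of "(a, part lam a)" "(c, part lam c)" S k] k by auto
    have "\<not> part mu k + 2 \<le> part lam (Suc k)"
    proof
      assume *: "part mu k + 2 \<le> part lam (Suc k)"
      have "part mu (Suc k) \<le> part mu k" "part lam (Suc k) \<le> part lam k"
        using part_mono[OF mu, of k "Suc k"] part_mono[OF lam, of k "Suc k"] range k by auto
      then have "contains_2x2 S"
        unfolding contains_2x2_def using * range k
        by (intro exI[of _ k] exI[of _ "Suc (part mu k)"]) (auto simp: S)
      with no2 show False ..
    qed
    then show ?thesis using j by (simp add: S)
  qed
  let ?f = "bead r lam" and ?g = "bead r mu"
  have beta: "beta r mu = insert (?g c) (beta r lam - {?f a})"
    unfolding beta_def
  proof (rule image_cyclic_shift[OF range(1) ac(3) range(2) inj_on_bead[OF lam]])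
    show "?g i = ?f (Suc i)" if "a \<le> i" "i < c" for i
      using shift[OF that] that range by (simp add: bead_def)
    show "?g i = ?f i" if "i \<in> {1..r}" "i < a \<or> c < i" for i
      using outR[OF that(2)] le[of i] that by (force simp: R bead_def)
  qed
  have fa: "?f a \<in> beta r lam"
    using range ac by (auto simp: beta_def)
  \<comment> \<open>A coincidence would leave \<open>mu\<close> with only \<open>r - 1\<close>
    beads.\<close>
  have new: "?g c \<notin> beta r lam - {?f a}"
  proof
    assume "?g c \<in> beta r lam - {?f a}"
    then have "card (beta r mu) = r - 1"
      using fa by (simp add: beta insert_absorb card_beta[OF lam])
    then show False using card_beta[OF mu, of r] range ac by simp
  qed
  \<comment> \<open>All other beads are common to both sets, so the difference \<open>t\<close> of
    the sizes is the distance between the two exchanged beads.\<close>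
  have "\<Sum>(beta r mu) = ?g c + \<Sum>(beta r lam - {?f a})"
    unfolding beta using new by simp
  moreover have "\<Sum>(beta r lam) = ?f a + \<Sum>(beta r lam - {?f a})"
    using sum.remove[OF _ fa, of "\<lambda>x. x"] by simp
  ultimately have "?g c + t = ?f a"
    using sum_beta[OF lam len] sum_beta[OF mu lenmu] size by simp
  then have "bead_move t (beta r lam) (beta r mu)"
    unfolding bead_move_def using beta new fa t by (intro exI[of _ "?g c"]) auto
  with lenmu size show ?thesis by blast
qed

text \<open>The hook runs from the row \<open>a\<close> of the bead \<open>b + t\<close> to the last
  row \<open>c\<close> whose bead exceeds \<open>b\<close>. The rows \<open>a\<close> to
  \<open>c - 1\<close> take over the bead of the next row, and row \<open>c\<close> takes
  \<open>b\<close>.\<close>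

lemma bead_move_rim_hook:
  assumes lam: "is_partition lam" "length lam \<le> r" and t: "1 \<le> t"
    and move: "bead_move t (beta r lam) B"
  shows "\<exists>mu. removes_rim_hook t lam mu"
proof -
  let ?f = "bead r lam"
  obtain b where b: "b + t \<in> beta r lam" "b \<notin> beta r lam"
    using move by (auto simp: bead_move_def)
  then obtain a where a: "a \<in> {1..r}" "?f a = b + t" by (auto simp: beta_def)
  define C where "C = {j \<in> {1..r}. b < ?f j}"
  have "finite C" "a \<in> C" using a t by (auto simp: C_def)
  define c where "c = Max C"
  have c: "c \<in> C" "a \<le> c"
    unfolding c_def using \<open>a \<in> C\<close> Max_in[OF \<open>finite C\<close>] Max_ge[OF \<open>finite C\<close>] by blast+
  have rng: "1 \<le> a" "c \<le> r" "b < ?f c" using a c by (auto simp: C_def)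
  have after: "?f j < b" if "c < j" "j \<le> r" for j
  proof -
    have "j \<notin> C" using Max_ge[OF \<open>finite C\<close>, of j] that by (auto simp: c_def)
    moreover have "?f j \<in> beta r lam" using that by (auto simp: beta_def)
    ultimately have "\<not> b < ?f j" "?f j \<noteq> b" using b(2) that rng c by (auto simp: C_def)
    then show ?thesis by simp
  qed
  \<comment> \<open>The bead of row \<open>Suc c\<close>, if \<open>c < r\<close>, is at least
    \<open>r - Suc c\<close> and less than \<open>b\<close>. The bound makes the subtraction in
    \<open>h c\<close> exact.\<close>
  have bc: "r - c \<le> b"
    using after[of "Suc c"] by (cases "c < r") (auto simp: bead_def)
  \<comment> \<open>Bead positions turned into row lengths: taking over the bead of row
    \<open>Suc i\<close> costs row \<open>i\<close> one column, and row \<open>c\<close> is cut so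
    that its bead becomes \<open>b\<close>.\<close>
  define h where "h i = (if i < a \<or> c < i then part lam i
      else if i < c then part lam (Suc i) - 1 else b - (r - c))" for i
  have pm: "part lam (Suc i) \<le> part lam i" if "1 \<le> i" for i
    using part_mono[OF lam(1), of i "Suc i"] that by simp
  have hc: "h c < part lam c" using rng bc c by (simp add: h_def bead_def)
  have pos: "0 < part lam i" if "1 \<le> i" "i \<le> c" for i
    using part_mono[OF lam(1) that] hc by simp
  have hless: "h i < part lam i" if "a \<le> i" "i \<le> c" for i
  proof (cases "i = c")
    case False
    then show ?thesis using pm[of i] pos[of i] that rng by (auto simp: h_def)
  qed (use hc in simp)
  have hmid: "part lam (Suc i) = Suc (h i)" if "a \<le> i" "i < c" for i
    using that pos[of "Suc i"] by (simp add: h_def)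
  have hout: "h i = part lam i" if "i < a \<or> c < i" for i
    using that by (auto simp: h_def)
  have mono: "h (Suc i) \<le> h i" if i: "1 \<le> i" for i
  proof -
    consider "i < a" | "a \<le> i" "i < c" | "i = c" | "c < i" by linarith
    then show ?thesis
    proof cases
      case 1
      then show ?thesis using hout[of i] hout[of "Suc i"] hless[of "Suc i"] pm[OF i] c
        by (cases "Suc i < a") auto
    next
      case 2
      then show ?thesis using hmid[of i] hless[of "Suc i"] by simp
    next
      case 3
      show ?thesis
      proof (cases "c < r")
        case True
        then show ?thesis using after[of "Suc c"] 3 c by (simp add: h_def bead_def)
      qed (use 3 lam hout in \<open>auto simp: part_def\<close>)
    qed (use pm[OF i] hout in auto)
  qed
  have zero: "h i = 0" if "r < i" for i
    using that rng lam by (auto simp: h_def part_def)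
  obtain mu where mu: "is_partition mu" "length mu \<le> r" and pmu: "\<And>i. i \<ge> 1 \<Longrightarrow> part mu i = h i"
    using ex_partition[of h r, OF mono zero] by blast
  define S where "S = diagram lam - diagram mu"
  have S: "(i, j) \<in> S \<longleftrightarrow> a \<le> i \<and> i \<le> c \<and> h i < j \<and> j \<le> part lam i" for i j
    by (cases "i < a \<or> c < i") (use rng hout[of i] in \<open>auto simp: S_def mem_diagram pmu not_le\<close>)
  have sub: "diagram mu \<subseteq> diagram lam"
  proof (rule subrelI)
    fix i j assume "(i, j) \<in> diagram mu"
    then have ij: "1 \<le> i" "1 \<le> j" "j \<le> h i" by (auto simp: mem_diagram pmu)
    moreover have "h i \<le> part lam i"
      using hless[of i] hout[of i] by (cases "i < a \<or> c < i") simp_all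
    ultimately show "(i, j) \<in> diagram lam" by (simp add: mem_diagram)
  qed
  have "beta r mu = insert (bead r mu c) (beta r lam - {?f a})"
    unfolding beta_def
  proof (rule image_cyclic_shift[OF rng(1) c(2) rng(2) inj_on_bead[OF lam(1)]])
    show "bead r mu i = ?f (Suc i)" if "a \<le> i" "i < c" for i
      using hmid[OF that] that rng by (simp add: bead_def pmu)
    show "bead r mu i = ?f i" if "i \<in> {1..r}" "i < a \<or> c < i" for i
      using hout[OF that(2)] that by (simp add: bead_def pmu)
  qed
  then have beta: "beta r mu = insert b (beta r lam - {b + t})"
    using a bc rng c by (simp add: bead_def pmu h_def)
  have "\<Sum>(beta r mu) = b + \<Sum>(beta r lam - {b + t})"
    unfolding beta using b by simp
  moreover have "\<Sum>(beta r lam) = b + t + \<Sum>(beta r lam - {b + t})"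
    using sum.remove[OF _ b(1), of "\<lambda>x. x"] by simp
  ultimately have card: "card S = t"
    using sum_beta[OF lam] sum_beta[OF mu]
    by (simp add: S_def card_Diff_subset finite_diagram sub card_diagram)
  \<comment> \<open>Below a row \<open>i\<close> of the hook, the next hook row ends in column
    \<open>Suc (h i)\<close>, the first column of \<open>S\<close> in row \<open>i\<close>, so the
    two rows share only that column.\<close>
  have no2: "\<not> contains_2x2 S"
  proof
    assume "contains_2x2 S"
    then obtain i j where "(i, j) \<in> S" "(Suc i, Suc j) \<in> S" by (auto simp: contains_2x2_def)
    then show False using hmid[of i] by (simp add: S)
  qed
  let ?A = "adjacent_boxes \<inter> S \<times> S"
  have sym: "sym ?A" by (auto simp: sym_def adjacent_boxes_def)
  \<comment> \<open>Every box is joined to the right end of row \<open>a\<close>: go right to the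
    end of the row, step up into the hook, and repeat.\<close>
  have row: "((i, j), (i, part lam i)) \<in> ?A\<^sup>*" if "(i, j) \<in> S" for i j
  proof -
    have "j \<le> part lam i" using that by (simp add: S)
    then show ?thesis using that
    proof (induction j rule: inc_induct)
      case (step j)
      then have "(i, Suc j) \<in> S" by (simp add: S)
      moreover from this have "((i, j), (i, Suc j)) \<in> ?A"
        using step by (simp add: adjacent_boxes_def)
      ultimately show ?case using step by (meson converse_rtrancl_into_rtrancl)
    qed simp
  qed
  have column: "((i, part lam i), (a, part lam a)) \<in> ?A\<^sup>*" if "a \<le> i" "i \<le> c" for i
    using that
  proof (induction i rule: dec_induct)
    case (step i)
    let ?p = "(i, part lam (Suc i))"
    have p: "?p \<in> S" "(Suc i, part lam (Suc i)) \<in> S"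
      using step hmid[of i] hless[of i] hless[of "Suc i"] by (auto simp: S)
    then have "((Suc i, part lam (Suc i)), ?p) \<in> ?A" by (simp add: adjacent_boxes_def)
    then show ?case
      using row[OF p(1)] step by (meson Suc_leD converse_rtrancl_into_rtrancl rtrancl_trans)
  qed simp
  have root: "(x, (a, part lam a)) \<in> ?A\<^sup>*" if "x \<in> S" for x
    using that row column by (cases x) (meson S rtrancl_trans)
  have "connected_boxes S"
    unfolding connected_boxes_def
    using root sym_rtrancl[OF sym] by (meson rtrancl_trans symD)
  then have "removes_rim_hook t lam mu"
    using lam mu sub no2 card by (simp add: removes_rim_hook_def S_def)
  then show ?thesis ..
qed

subsection \<open>Runners and cores\<close>

text \<open>A runner is recorded by the quotients \<open>k\<close> and not by the positions
  \<open>i + t * k\<close>, so that a slide by \<open>t\<close> becomes a slide by one.\<close>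

definition runner :: "nat \<Rightarrow> nat set \<Rightarrow> nat \<Rightarrow> nat set" where
  "runner t B i = {k. i + t * k \<in> B}"

lemma runner_position: "(i :: nat) < t \<Longrightarrow> i + t * k = x \<longleftrightarrow> i = x mod t \<and> k = x div t"
  by auto

lemma finite_runner:
  assumes "finite B" "1 \<le> t"
  shows "finite (runner t B i)"
proof -
  have "inj (\<lambda>k. i + t * k)" using assms(2) by (auto simp: inj_def)
  then have "finite ((\<lambda>k. i + t * k) -` B)" by (rule finite_vimageI[OF assms(1)])
  then show ?thesis by (simp add: runner_def vimage_def)
qed

lemma runner_eqD:
  assumes "1 \<le> t" "\<And>i. i < t \<Longrightarrow> runner t B i = runner t C i"
  shows "B = C"
proof -
  have "x \<in> B \<longleftrightarrow> x \<in> C" for x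
  proof -
    have "x div t \<in> runner t B (x mod t) \<longleftrightarrow> x div t \<in> runner t C (x mod t)"
      using assms by simp
    then show ?thesis by (simp add: runner_def)
  qed
  then show ?thesis by blast
qed

text \<open>Division with remainder by \<open>t\<close> splits \<open>B\<close> into its
  runners.\<close>

lemma sum_runners:
  fixes h :: "nat \<Rightarrow> nat"
  assumes "finite B" "1 \<le> t"
  shows "sum h B = (\<Sum>i<t. \<Sum>k\<in>runner t B i. h (i + t * k))"
proof -
  have "(\<Sum>i<t. \<Sum>k\<in>runner t B i. h (i + t * k))
      = (\<Sum>(i, k)\<in>Sigma {..<t} (runner t B). h (i + t * k))"
    using assms by (intro sum.Sigma) (auto intro: finite_runner)
  also have "\<dots> = sum h B"
    using assms(2)
    by (intro sum.reindex_bij_witness[of _ "\<lambda>x. (x mod t, x div t)" "\<lambda>(i, k). i + t * k"])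
       (auto simp: runner_def)
  finally show ?thesis ..
qed

text \<open>The positions \<open>b\<close> and \<open>b + t\<close> are neighbours on one runner,
  which exchanges one element for another, while all other runners stay the same.\<close>

lemma card_runner_bead_move:
  assumes "bead_move t B B'" "finite B" "i < t"
  shows "card (runner t B' i) = card (runner t B i)"
proof -
  obtain b where b: "b + t \<in> B" "b \<notin> B" "B' = insert b (B - {b + t})"
    using assms(1) by (auto simp: bead_move_def)
  have mem: "k \<in> runner t B' i \<longleftrightarrow> i = b mod t \<and> k = b div t \<or>
      k \<in> runner t B i \<and> \<not> (i = b mod t \<and> k = Suc (b div t))" for k
    using runner_position[OF assms(3), of k b] runner_position[OF assms(3), of k "b + t"] assms(3)
    by (auto simp: runner_def b(3))
  show ?thesis
  proof (cases "i = b mod t")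
    case True
    then have eq: "runner t B' i = insert (b div t) (runner t B i - {Suc (b div t)})"
      using mem by auto
    have "i + t * Suc (b div t) = b + t" using True by simp
    then have "Suc (b div t) \<in> runner t B i" "b div t \<notin> runner t B i"
      using b True by (simp_all add: runner_def)
    then show ?thesis
      unfolding eq using finite_runner[OF assms(2), of t i] assms(3)
        card_Suc_Diff1[of "runner t B i" "Suc (b div t)"] by simp
  next
    case False
    then have "runner t B' i = runner t B i" using mem by blast
    then show ?thesis by simp
  qed
qed

section \<open>Flush bead sets and the core\<close>

definition flush :: "nat \<Rightarrow> nat set \<Rightarrow> bool" where
  "flush t B \<longleftrightarrow> (\<forall>b. b + t \<in> B \<longrightarrow> b \<in> B)"

lemma down_closed_eq_lessThan:
  assumes "finite X" and "\<And>k. Suc k \<in> X \<Longrightarrow> k \<in> X"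
  shows "X = {..<card X}"
proof (cases "X = {}")
  case False
  have down: "k \<in> X" if "m \<in> X" "k \<le> m" for k m
    using that(2,1) by (induction k rule: inc_induct) (auto intro: assms(2))
  have "X = {..<Suc (Max X)}"
    using down[OF Max_in[OF assms(1) False]] Max_ge[OF assms(1)] by (auto simp: less_Suc_eq_le)
  then show ?thesis by (metis card_lessThan)
qed simp

lemma runner_flush:
  assumes "flush t B" "finite B" "1 \<le> t"
  shows "runner t B i = {..<card (runner t B i)}"
  using assms by (intro down_closed_eq_lessThan finite_runner)
    (auto simp: runner_def flush_def add.assoc ac_simps)

text \<open>On each runner of a flush set the beads fill the lowest positions, so their number
  determines them.\<close>

lemma flush_unique:
  assumes "flush t B" "finite B" "flush t C" "finite C" "1 \<le> t"
    and "\<And>i. i < t \<Longrightarrow> card (runner t B i) = card (runner t C i)"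
  shows "B = C"
proof (rule runner_eqD[OF assms(5)])
  fix i assume "i < t"
  have "runner t B i = {..<card (runner t B i)}"
    by (rule runner_flush[OF assms(1,2,5)])
  also have "\<dots> = {..<card (runner t C i)}"
    using assms(6) \<open>i < t\<close> by simp
  also have "\<dots> = runner t C i"
    by (rule runner_flush[OF assms(3,4,5), symmetric])
  finally show "runner t B i = runner t C i" .
qed

lemma terminal_iff_flush:
  assumes "is_partition lam" "length lam \<le> r" "1 \<le> t"
  shows "(\<nexists>nu. removes_rim_hook t lam nu) \<longleftrightarrow> flush t (beta r lam)"
proof
  assume terminal: "\<nexists>nu. removes_rim_hook t lam nu"
  show "flush t (beta r lam)"
    unfolding flush_def
  proof (intro allI impI)
    fix b assume "b + t \<in> beta r lam"
    then show "b \<in> beta r lam"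
      using bead_move_rim_hook[OF assms, of "insert b (beta r lam - {b + t})"] terminal
      by (auto simp: bead_move_def)
  qed
next
  assume "flush t (beta r lam)"
  then have "\<not> bead_move t (beta r lam) B" for B by (auto simp: flush_def bead_move_def)
  then show "\<nexists>nu. removes_rim_hook t lam nu" using rim_hook_bead_move[OF _ assms(3,2)] by blast
qed

lemma removes_rim_hooks_runners:
  assumes "(removes_rim_hook t)\<^sup>*\<^sup>* lam mu" "is_partition lam" "length lam \<le> r" "1 \<le> t"
  shows "is_partition mu \<and> length mu \<le> r \<and>
    (\<forall>i<t. card (runner t (beta r mu) i) = card (runner t (beta r lam) i))"
  using assms(1)
proof (induction rule: rtranclp_induct)
  case (step mu nu)
  have "is_partition nu" using step by (simp add: removes_rim_hook_def)
  with step show ?case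
    using rim_hook_bead_move[of t mu nu r] assms(4)
      card_runner_bead_move[of t "beta r mu" "beta r nu"]
    by simp
qed (use assms in simp)

text \<open>Each removal lowers the size by \<open>t\<close>, so removals terminate.\<close>

lemma ex_terminal:
  assumes "1 \<le> t"
  shows "\<exists>mu. (removes_rim_hook t)\<^sup>*\<^sup>* lam mu \<and> (\<nexists>nu. removes_rim_hook t mu nu)"
proof (induction "sum_list lam" arbitrary: lam rule: less_induct)
  case less
  show ?case
  proof (cases "\<exists>nu. removes_rim_hook t lam nu")
    case True
    then obtain nu where nu: "removes_rim_hook t lam nu" by blast
    then have "sum_list nu < sum_list lam"
      using rim_hook_bead_move[OF nu assms order_refl] assms by simp
    then show ?thesis using less nu by (meson converse_rtranclp_into_rtranclp)
  qed blast
qed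

text \<open>A terminal partition is flush and has the runner counts of \<open>lam\<close>, and these
  data determine it. This justifies the definite description in \<open>core\<close> and replaces
  sequences of removals by a condition on bead counts.\<close>

lemma core_eq_iff:
  assumes lam: "is_partition lam" "length lam \<le> r" and rho: "is_partition rho" "length rho \<le> r"
    and t: "1 \<le> t"
  shows "core t lam = rho \<longleftrightarrow> flush t (beta r rho) \<and>
    (\<forall>i<t. card (runner t (beta r lam) i) = card (runner t (beta r rho) i))"
proof -
  let ?P = "\<lambda>mu. (removes_rim_hook t)\<^sup>*\<^sup>* lam mu \<and> (\<nexists>nu. removes_rim_hook t mu nu)"
  have P: "is_partition mu \<and> length mu \<le> r \<and> flush t (beta r mu) \<and>
      (\<forall>i<t. card (runner t (beta r lam) i) = card (runner t (beta r mu) i))" if "?P mu" for mu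
    using removes_rim_hooks_runners[OF _ lam t, of mu] terminal_iff_flush[of mu r t] that t by auto
  obtain mu where mu: "?P mu" using ex_terminal[OF t] by blast
  have unique: "nu = mu" if "is_partition nu" "length nu \<le> r" "flush t (beta r nu)"
    "\<forall>i<t. card (runner t (beta r lam) i) = card (runner t (beta r nu) i)" for nu
    using P[OF mu] that flush_unique[of t "beta r nu" "beta r mu"] t
    by (intro beta_inject[of nu r mu]) auto
  have "core t lam = mu"
    unfolding core_def
  proof (rule the_equality, rule mu)
    fix nu assume "?P nu"
    from P[OF this] show "nu = mu" using unique[of nu] by blast
  qed
  then show ?thesis using P[OF mu] unique[OF rho] by blast
qed

text \<open>Flushness concerns \<open>rho\<close> alone and follows from its being a core, so only
  the bead counts remain.\<close>

lemma partitions_with_core_eq: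
  assumes rho: "rho \<in> partitions_in r s" "is_core t rho" and t: "1 \<le> t"
  shows "partitions_with_core t r s rho = {lam \<in> partitions_in r s.
    \<forall>i<t. card (runner t (beta r lam) i) = card (runner t (beta r rho) i)}"
proof -
  have r: "is_partition rho" "length rho \<le> r"
    using rho by (simp_all add: partitions_in_def)
  have "flush t (beta r rho)"
    using core_eq_iff[OF r r t] rho(2) by (simp add: is_core_def)
  then show ?thesis
    using core_eq_iff[OF _ _ r t] by (auto simp: partitions_with_core_def partitions_in_def)
qed

subsection \<open>Partitions with a given core\<close>

text \<open>For \<open>i < t\<close> the quotient is the ceiling of \<open>(r + s - i) / t\<close>,
  the number of positions below \<open>r + s\<close> congruent to \<open>i\<close>.\<close>

lemma less_runner_length:
  assumes i: "i < t"
  shows "k < runner_length r s t i \<longleftrightarrow> i + t * k < r + s"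
proof -
  have "k < runner_length r s t i \<longleftrightarrow> Suc k * t \<le> r + s + t - 1 - i"
    using i by (simp add: runner_length_def less_eq_div_iff_mult_less_eq flip: Suc_le_eq)
  also have "\<dots> \<longleftrightarrow> i + t * k < r + s"
    using i by (auto simp: mult.commute)
  finally show ?thesis .
qed

text \<open>The runners can be chosen independently. Restricting to \<open>{..<t}\<close> makes the
  tuple of runners an element of a \<open>PiE\<close> set, over which sums of products
  factor.\<close>

lemma bij_betw_runners:
  assumes rho: "rho \<in> partitions_in r s" "is_core t rho" and r: "1 \<le> r" and t: "1 \<le> t"
  shows "bij_betw (\<lambda>lam. \<lambda>i\<in>{..<t}. runner t (beta r lam) i) (partitions_with_core t r s rho)
    (PiE {..<t} (\<lambda>i. {X. X \<subseteq> {..<runner_length r s t i} \<and>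
      card X = card (runner t (beta r rho) i)}))"
    (is "bij_betw ?\<phi> ?D ?E")
  unfolding bij_betw_def
proof
  note D = partitions_with_core_eq[OF rho t]
  have rho': "is_partition rho" using rho by (simp add: partitions_in_def)
  show "inj_on ?\<phi> ?D"
  proof (rule inj_onI)
    fix lam mu assume lm: "lam \<in> ?D" "mu \<in> ?D" and eq: "?\<phi> lam = ?\<phi> mu"
    have "runner t (beta r lam) i = runner t (beta r mu) i" if "i < t" for i
      using fun_cong[OF eq, of i] that by simp
    then have "beta r lam = beta r mu" by (rule runner_eqD[OF t])
    then show "lam = mu" using lm by (auto simp: D partitions_in_def intro: beta_inject)
  qed
  show "?\<phi> ` ?D = ?E"
  proof
    show "?\<phi> ` ?D \<subseteq> ?E"
    proof (rule image_subsetI)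
      fix lam assume lam: "lam \<in> ?D"
      then have "beta r lam \<subseteq> {..<r + s}"
        using beta_subset_iff[of lam r s] r by (auto simp: D partitions_in_def)
      then have "runner t (beta r lam) i \<subseteq> {..<runner_length r s t i}" if "i < t" for i
        using less_runner_length[OF that] by (auto simp: runner_def)
      then show "?\<phi> lam \<in> ?E" using lam by (auto simp: D)
    qed
    show "?E \<subseteq> ?\<phi> ` ?D"
    proof
      fix g assume g: "g \<in> ?E"
      \<comment> \<open>The runners given by \<open>g\<close>, glued to one bead set by division
        with remainder.\<close>
      define B where "B = {x. x div t \<in> g (x mod t)}"
      have g': "k < runner_length r s t i" if "i < t" "k \<in> g i" for i k
        using g that by (auto simp: PiE_iff)
      have B: "B \<subseteq> {..<r + s}"
      proof
        fix x assume "x \<in> B"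
        then have "x div t < runner_length r s t (x mod t)"
          using t by (intro g') (auto simp: B_def)
        then show "x \<in> {..<r + s}" using less_runner_length[of "x mod t" t] t by simp
      qed
      have fin: "finite B" by (rule finite_subset[OF B]) simp
      have run: "runner t B i = g i" if "i < t" for i
        using that by (auto simp: runner_def B_def)
      have card: "card (g i) = card (runner t (beta r rho) i)" if "i < t" for i
        using g that by (auto simp: PiE_iff)
      \<comment> \<open>The runner sizes prescribed by \<open>rho\<close> add up to
        \<open>r\<close>, as needed to read \<open>B\<close> as the bead set of a partition with at
        most \<open>r\<close> parts.\<close>
      have "card B = card (beta r rho)"
        using sum_runners[OF fin t, of "\<lambda>_. 1"] sum_runners[OF finite_beta t, of "\<lambda>_. 1"]
        by (simp add: run card)
      then obtain lam where lam: "is_partition lam" "length lam \<le> r" "beta r lam = B"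
        using ex_beta[OF fin] card_beta[OF rho'] by metis
      have "lam \<in> ?D"
        using lam B beta_subset_iff[OF lam(1,2) r, of s] run card by (simp add: D partitions_in_def)
      moreover have "?\<phi> lam = g"
        using g run by (intro ext) (auto simp: lam(3) PiE_iff extensional_def)
      ultimately show "g \<in> ?\<phi> ` ?D" by blast
    qed
  qed
qed

section \<open>Bead counts in the words of the abacus\<close>

lemma abacus_eq_1_iff:
  assumes "length lam \<le> r"
  shows "abacus lam (int x - int r) = 1 \<longleftrightarrow> x \<in> beta r lam"
proof -
  \<comment> \<open>Rows beyond \<open>r\<close> are empty and give the values \<open>- j\<close>,
    which lie below \<open>- r\<close> and match no natural number \<open>x\<close>.\<close>
  have "int x - int r = int (part lam j) - int j \<longleftrightarrow> j \<le> r \<and> x = bead r lam j" if "1 \<le> j" for j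
    using assms that by (cases "j \<le> r") (auto simp: bead_def part_def)
  then have "(\<exists>j\<ge>1. int x - int r = int (part lam j) - int j) \<longleftrightarrow>
      (\<exists>j. j \<in> {1..r} \<and> x = bead r lam j)"
    by (metis atLeastAtMost_iff)
  then show ?thesis by (simp add: abacus_def beta_def image_iff Bex_def)
qed

text \<open>The word covers exactly the positions of the runner below \<open>r + s\<close>, and the
  box condition leaves no bead beyond them.\<close>

lemma ones_runner_word:
  assumes "lam \<in> partitions_in r s" "1 \<le> r" "i < t"
  shows "ones (runner_word r s t lam i) = card (runner t (beta r lam) i)"
proof -
  have lam: "is_partition lam" "length lam \<le> r" "beta r lam \<subseteq> {..<r + s}"
    using assms beta_subset_iff[of lam r s] by (auto simp: partitions_in_def)
  have abacus: "1 = abacus lam (- int r + int i + int t * int k) \<longleftrightarrow> i + t * k \<in> beta r lam" for k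
  proof -
    have "- int r + int i + int t * int k = int (i + t * k) - int r" by simp
    then show ?thesis using abacus_eq_1_iff[OF lam(2), of "i + t * k"] by metis
  qed
  have "ones (runner_word r s t lam i)
      = length (filter (\<lambda>k. i + t * k \<in> beta r lam) [0..<runner_length r s t i])"
    unfolding ones_def runner_word_def count_list_eq_length_filter filter_map length_map comp_def
    by (intro arg_cong[where f = length] filter_cong) (simp_all only: abacus)
  also have "\<dots> = card {k. k < runner_length r s t i \<and> i + t * k \<in> beta r lam}"
    by (subst distinct_card[symmetric]) (auto intro!: arg_cong[where f = card])
  also have "\<dots> = card (runner t (beta r lam) i)"
    using lam(3) less_runner_length[OF assms(3)]
    by (auto simp: runner_def intro!: arg_cong[where f = card])
  finally show ?thesis .
qed

subsection \<open>Subset sums and q-binomial coefficients\<close>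

lemma poly_q_int_1: "poly (q_int n) 1 = int n"
  by (induction n) (simp_all add: q_int_def poly_monom)

lemma q_fact_nonzero: "q_fact n \<noteq> 0"
proof (induction n)
  case (Suc n)
  have "q_int (Suc n) \<noteq> 0" using poly_q_int_1[of "Suc n"]
    by (metis of_nat_eq_0_iff nat.distinct(1) poly_0)
  with Suc show ?case by (simp add: q_fact_Suc)
qed (simp add: q_fact_0)

text \<open>The \<open>q\<close>-Pascal recurrence: subsets are split by whether they contain
  \<open>n\<close>, which contributes the factor \<open>monom 1 n\<close>.\<close>

lemma sum_subsets_Suc:
  "(\<Sum>X | X \<subseteq> {..<Suc n} \<and> card X = Suc a. monom (1::int) (\<Sum>X)) =
    (\<Sum>X | X \<subseteq> {..<n} \<and> card X = Suc a. monom 1 (\<Sum>X)) +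
    monom 1 n * (\<Sum>X | X \<subseteq> {..<n} \<and> card X = a. monom 1 (\<Sum>X))"
proof -
  let ?F = "\<lambda>n a. {X. X \<subseteq> {..<n::nat} \<and> card X = a}"
  have fin: "finite (?F n a)" for n a
    by (rule finite_subset[of _ "Pow {..<n}"]) auto
  have mem: "n \<notin> X" "finite X" if "X \<in> ?F n a" for X a
    using that by (auto intro: finite_subset)
  have split: "?F (Suc n) (Suc a) = ?F n (Suc a) \<union> insert n ` ?F n a"
  proof (intro subset_antisym subsetI)
    fix X assume X: "X \<in> ?F (Suc n) (Suc a)"
    then have "finite X" by (auto intro: finite_subset)
    show "X \<in> ?F n (Suc a) \<union> insert n ` ?F n a"
    proof (cases "n \<in> X")
      case True
      then have "X = insert n (X - {n})" "X - {n} \<in> ?F n a"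
        using X \<open>finite X\<close> by (auto simp: lessThan_Suc)
      then show ?thesis by blast
    qed (use X in \<open>auto simp: lessThan_Suc\<close>)
  next
    fix X assume "X \<in> ?F n (Suc a) \<union> insert n ` ?F n a"
    then show "X \<in> ?F (Suc n) (Suc a)"
    proof
      assume "X \<in> insert n ` ?F n a"
      then obtain Y where "Y \<in> ?F n a" "X = insert n Y" by blast
      then show ?thesis using mem[of Y a] by (auto simp: lessThan_Suc)
    qed (auto simp: lessThan_Suc)
  qed
  have inj: "inj_on (insert n) (?F n a)"
  proof (rule inj_onI)
    fix X Y assume X: "X \<in> ?F n a" and Y: "Y \<in> ?F n a" and eq: "insert n X = insert n Y"
    show "X = Y" using insert_ident[OF mem(1)[OF X] mem(1)[OF Y]] eq by (rule iffD1)
  qed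
  have "(\<Sum>X\<in>?F (Suc n) (Suc a). monom (1::int) (\<Sum>X))
      = (\<Sum>X\<in>?F n (Suc a). monom 1 (\<Sum>X)) + (\<Sum>X\<in>insert n ` ?F n a. monom 1 (\<Sum>X))"
    unfolding split
  proof (rule sum.union_disjoint)
    show "?F n (Suc a) \<inter> insert n ` ?F n a = {}" using mem(1)[of _ "Suc a"] by blast
  qed (simp_all add: fin)
  also have "(\<Sum>X\<in>insert n ` ?F n a. monom (1::int) (\<Sum>X)) = (\<Sum>X\<in>?F n a. monom 1 n * monom 1 (\<Sum>X))"
    unfolding sum.reindex[OF inj]
  proof (rule sum.cong[OF refl])
    fix X assume "X \<in> ?F n a"
    then show "((\<lambda>X. monom (1::int) (\<Sum>X)) \<circ> insert n) X = monom 1 n * monom 1 (\<Sum>X)"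
      using mem[of X a] by (simp add: mult_monom)
  qed
  finally show ?thesis by (simp add: sum_distrib_left)
qed

lemma no_subsets:
  fixes n a :: nat
  assumes "n < a"
  shows "{X. X \<subseteq> {..<n} \<and> card X = a} = {}"
proof (rule equals0I)
  fix X assume "X \<in> {X. X \<subseteq> {..<n} \<and> card X = a}"
  then show False using card_mono[of "{..<n}" X] assms by simp
qed

text \<open>Denominators are cleared so that the induction needs no division of polynomials. The
  factor \<open>monom 1 (\<Sum>{..<a})\<close> is the weight of the smallest subset.\<close>

lemma sum_subsets_q_fact:
  assumes "a \<le> n"
  shows "(\<Sum>X | X \<subseteq> {..<n} \<and> card X = a. monom (1::int) (\<Sum>X)) * (q_fact a * q_fact (n - a)) =
    monom 1 (\<Sum>{..<a}) * q_fact n"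
  using assms
proof (induction n arbitrary: a)
  case 0
  have "{X. X = {} \<and> card X = 0} = {{} :: nat set}" by auto
  then show ?case using 0 by (simp add: q_fact_0)
next
  case (Suc n)
  define G where "G n a = (\<Sum>X | X \<subseteq> {..<n} \<and> card X = a. monom (1::int) (\<Sum>X))" for n a
  note IH = Suc.IH[folded G_def]
  show ?case
  proof (cases a)
    case 0
    have "{X. X \<subseteq> {..<Suc n} \<and> card X = 0} = {{}}"
      by (auto dest: finite_subset)
    then show ?thesis using 0 by (simp add: q_fact_0)
  next
    case (Suc c)
    with Suc.prems have c: "c \<le> n" by simp
    let ?e = "\<Sum>{..<c}"
    have "G n (Suc c) * (q_fact (Suc c) * q_fact (n - c)) =
        monom 1 (?e + c) * q_int (n - c) * q_fact n"
    proof (cases "c = n")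
      case True
      \<comment> \<open>No subset is larger than the ground set, and the right-hand side vanishes
        with \<open>q_int 0\<close>.\<close>
      then have "G n (Suc c) = 0" by (simp add: G_def no_subsets)
      then show ?thesis using True by (simp add: q_int_def)
    next
      case False
      then have "q_fact (n - c) = q_int (n - c) * q_fact (n - Suc c)"
        using c q_fact_Suc[of "n - Suc c"] by (simp add: Suc_diff_Suc)
      then show ?thesis using IH[of "Suc c"] False c by (simp add: mult_ac)
    qed
    moreover have "monom 1 n * G n c * (q_fact (Suc c) * q_fact (n - c))
        = monom 1 (?e + c) * (monom 1 (n - c) * q_int (Suc c)) * q_fact n"
    proof -
      have "monom 1 n * G n c * (q_fact (Suc c) * q_fact (n - c))
          = monom 1 n * q_int (Suc c) * (G n c * (q_fact c * q_fact (n - c)))"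
        by (simp add: q_fact_Suc mult_ac)
      also have "\<dots> = (monom 1 n * monom 1 ?e) * (q_int (Suc c) * q_fact n)"
        unfolding IH[OF c] by (simp add: mult_ac)
      \<comment> \<open>The exponent \<open>n\<close> is split into \<open>c\<close>, which
        completes \<open>?e\<close> to \<open>\<Sum>{..<Suc c}\<close>, and \<open>n - c\<close>,
        which \<open>q_int_add\<close> absorbs below.\<close>
      also have "monom 1 n * monom 1 ?e = monom (1::int) (?e + c) * monom 1 (n - c)"
        using c by (simp add: mult_monom add.commute)
      finally show ?thesis by (simp add: mult_ac)
    qed
    ultimately have "G (Suc n) (Suc c) * (q_fact (Suc c) * q_fact (n - c))
        = monom 1 (?e + c) * (q_int (n - c) + monom 1 (n - c) * q_int (Suc c)) * q_fact n"
      by (simp add: G_def sum_subsets_Suc distrib_left distrib_right)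
    also have "q_int (n - c) + monom 1 (n - c) * q_int (Suc c) = q_int (Suc n)"
      using q_int_add[of "n - c" "Suc c"] c by simp
    finally show ?thesis
      using Suc by (simp add: G_def q_fact_Suc mult_ac)
  qed
qed

lemma sum_subsets_q_binomial:
  "(\<Sum>X | X \<subseteq> {..<n} \<and> card X = a. monom (1::int) (\<Sum>X)) =
    monom 1 (\<Sum>{..<a}) * q_binomial n a"
proof (cases "a \<le> n")
  case True
  let ?f = "q_fact a * q_fact (n - a)"
  have "(\<Sum>X | X \<subseteq> {..<n} \<and> card X = a. monom (1::int) (\<Sum>X)) * ?f =
      monom 1 (\<Sum>{..<a}) * q_binomial n a * ?f"
    using sum_subsets_q_fact[OF True] q_binomial_mult[OF True] by (simp add: mult.assoc)
  then show ?thesis using q_fact_nonzero by simp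
next
  case False
  then show ?thesis by (simp add: no_subsets q_binomial_def)
qed

lemma monom_1_sum: "monom (1 :: 'a :: comm_semiring_1) (\<Sum>x\<in>A. f x) = (\<Prod>x\<in>A. monom 1 (f x))"
  by (induction A rule: infinite_finite_induct)
    (simp_all add: mult_monom[of "1 :: 'a" _ 1, simplified, symmetric])

text \<open>Composition with \<open>monom 1 t\<close> is the substitution of \<open>q^t\<close> for
  \<open>q\<close>.\<close>

lemma pcompose_monom_1:
  "pcompose (monom (1 :: 'a :: comm_semiring_1) k) (monom 1 t) = monom 1 (t * k)"
  by (induction k) (simp_all add: monom_Suc pcompose_pCons mult_monom pcompose_1)

subsection \<open>The generating function\<close>

theorem theorem4p1:
  fixes r s t :: nat and rho :: "nat list"
  assumes "r \<ge> 1" and "s \<ge> 1" and "t \<ge> 2"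
    and "rho \<in> partitions_in r s" and "is_core t rho"
  shows "(\<Sum>lam\<in>partitions_with_core t r s rho. monom (1::int) (sum_list lam)) =
    monom 1 (sum_list rho) *
    (\<Prod>i<t. pcompose (q_binomial (runner_length r s t i) (ones (runner_word r s t rho i)))
                     (monom 1 t))"
proof -
  have t: "1 \<le> t" using assms(3) by simp
  have rho: "is_partition rho" "length rho \<le> r"
    using assms(4) by (simp_all add: partitions_in_def)
  define a where "a i = card (runner t (beta r rho) i)" for i
  define n where "n i = runner_length r s t i" for i
  define F where "F i = {X. X \<subseteq> {..<n i} \<and> card X = a i}" for i
  \<comment> \<open>The bead sum of the empty partition. Carrying it as a factor on both sides
    avoids subtracting exponents.\<close>
  define C where "C = (\<Sum>j=1..r. r - j)"
  define w where "w i X = (\<Sum>k\<in>X. i + t * k)" for i X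
  let ?D = "partitions_with_core t r s rho"
  let ?q = "monom (1::int)"
  have weight: "?q C * ?q (sum_list lam) = (\<Prod>i<t. ?q (w i (runner t (beta r lam) i)))"
    if "is_partition lam" "length lam \<le> r" for lam
    using sum_beta[OF that] sum_runners[OF finite_beta t, of "\<lambda>x. x" r lam]
    by (simp add: mult_monom C_def w_def add.commute flip: monom_1_sum)
  \<comment> \<open>The residues contribute \<open>i * a i\<close> for every choice of
    \<open>a i\<close> positions, and what varies is \<open>t\<close> times a subset sum, hence a
    power of \<open>q^t\<close>.\<close>
  have w: "w i X = i * a i + t * \<Sum>X" if "card X = a i" for i X
    using that by (simp add: w_def sum.distrib sum_distrib_left)
  have finF: "finite (F i)" for i
    by (rule finite_subset[of _ "Pow {..<n i}"]) (auto simp: F_def)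
  have "flush t (beta r rho)"
    using core_eq_iff[OF rho rho t] assms(5) by (simp add: is_core_def)
  then have rho_runner: "runner t (beta r rho) i = {..<a i}" for i
    unfolding a_def using runner_flush[OF _ finite_beta t] by blast
  \<comment> \<open>The core's own runner is the smallest choice \<open>{..<a i}\<close>, and its
    weight is exactly the monomial that splits off from the sum over all subsets.\<close>
  have runner_sum: "(\<Sum>X\<in>F i. ?q (w i X)) =
      ?q (w i (runner t (beta r rho) i)) * pcompose (q_binomial (n i) (a i)) (?q t)" for i
  proof -
    have "(\<Sum>X\<in>F i. ?q (w i X)) = (\<Sum>X\<in>F i. ?q (i * a i) * pcompose (?q (\<Sum>X)) (?q t))"
      by (intro sum.cong) (simp_all add: F_def w pcompose_monom_1 mult_monom)
    also have "\<dots> = ?q (i * a i) * pcompose (\<Sum>X\<in>F i. ?q (\<Sum>X)) (?q t)"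
      by (simp add: pcompose_sum sum_distrib_left)
    also have "(\<Sum>X\<in>F i. ?q (\<Sum>X)) = ?q (\<Sum>{..<a i}) * q_binomial (n i) (a i)"
      unfolding F_def by (rule sum_subsets_q_binomial)
    finally show ?thesis
      by (simp add: rho_runner w pcompose_mult pcompose_monom_1 mult_monom flip: mult.assoc)
  qed
  have "?q C * (\<Sum>lam\<in>?D. ?q (sum_list lam)) = (\<Sum>lam\<in>?D. ?q C * ?q (sum_list lam))"
    by (rule sum_distrib_left)
  also have "\<dots> = (\<Sum>lam\<in>?D. \<Prod>i<t. ?q (w i ((\<lambda>i\<in>{..<t}. runner t (beta r lam) i) i)))"
    by (intro sum.cong) (simp_all add: weight partitions_with_core_def partitions_in_def)
  also have "\<dots> = (\<Sum>g\<in>PiE {..<t} F. \<Prod>i<t. ?q (w i (g i)))"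
    using bij_betw_runners[OF assms(4,5,1) t] unfolding F_def a_def n_def
    by (rule sum.reindex_bij_betw)
  \<comment> \<open>The distributive law for a product of sums, read backwards.\<close>
  also have "\<dots> = (\<Prod>i<t. \<Sum>X\<in>F i. ?q (w i X))"
    using finF by (intro prod_sum_PiE[symmetric]) auto
  \<comment> \<open>By \<open>weight\<close>, the monomials of the core's runners multiply to
    \<open>?q C * ?q (sum_list rho)\<close>.\<close>
  also have "\<dots> = ?q C * (?q (sum_list rho) * (\<Prod>i<t. pcompose (q_binomial (n i) (a i)) (?q t)))"
    by (simp add: runner_sum prod.distrib weight[OF rho] flip: mult.assoc)
  finally have "(\<Sum>lam\<in>?D. ?q (sum_list lam)) =
      ?q (sum_list rho) * (\<Prod>i<t. pcompose (q_binomial (n i) (a i)) (?q t))"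
    by (simp add: monom_eq_0_iff)
  then show ?thesis
    using ones_runner_word[OF assms(4,1)] by (simp add: n_def a_def)
qed

end
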